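(* Let $n\ge1$. If $f\in\bigcup_{\alpha\in(0,1)}W^{\alpha,1}(\mathbb{R}^n)$, then $$\lim_{\alpha\to0^+}\alpha\int_{\mathbb{R}^n}|\nabla^\alpha f|\,dx=n\omega_n\mu_{n,0}\left|\int_{\mathbb{R}^n}f\,dx\right|.$$
   Context: $\omega_n=|B_1|$ is the volume of the unit ball of $\mathbb{R}^n$. For $\alpha\in[0,1)$, $\mu_{n,\alpha}:=2^{\alpha}\pi^{-\frac n2}\frac{\Gamma\left(\frac{n+\alpha+1}{2}\right)}{\Gamma\left(\frac{1-\alpha}{2}\right)}$. For $\alpha\in(0,1)$, $W^{\alpha,1}(\mathbb{R}^n)$ is the space of $f\in L^1(\mathbb{R}^n)$ with $[f]_{W^{\alpha,1}(\mathbb{R}^n)}=\int_{\mathbb{R}^n}\int_{\mathbb{R}^n}\frac{|f(x)-f(y)|}{|x-y|^{n+\alpha}}\,dx\,dy<+\infty$; one has $W^{\beta,1}(\mathbb{R}^n)\subset W^{\alpha,1}(\mathbb{R}^n)$ for $0<\alpha<\beta<1$. For $f\in W^{\alpha,1}(\mathbb{R}^n)$, the fractional $\alpha$-gradient is $$\nabla^\alpha f(x)=\mu_{n,\alpha}\int_{\mathbb{R}^n}\frac{(y-x)(f(y)-f(x))}{|y-x|^{n+\alpha+1}}\,dy,$$ which converges absolutely for a.e. $x\in\mathbb{R}^n$ and defines a function in $L^1(\mathbb{R}^n;\mathbb{R}^n)$. *)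

theory Defs
  imports "HOL-Analysis.Analysis"
begin

definition unit_ball_volume :: "'n::finite itself \<Rightarrow> real" where
  "unit_ball_volume _ = measure lebesgue (ball (0 :: real ^ 'n) 1)"

definition frac_const :: "nat \<Rightarrow> real \<Rightarrow> real" where
  "frac_const n \<alpha> =
     2 powr \<alpha> * pi powr (- real n / 2) * (Gamma ((real n + \<alpha> + 1) / 2) / Gamma ((1 - \<alpha>) / 2))"

text \<open>The seminorm takes extended values, so that its finiteness is a genuine condition.\<close>

definition frac_seminorm :: "real \<Rightarrow> (real ^ 'n::finite \<Rightarrow> real) \<Rightarrow> ennreal" where
  "frac_seminorm \<alpha> f =
     (\<integral>\<^sup>+ y. (\<integral>\<^sup>+ x. ennreal (\<bar>f x - f y\<bar> / norm (x - y) powr (real CARD('n) + \<alpha>)) \<partial>lebesgue) \<partial>lebesgue)"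

text \<open>Functions rather than classes modulo equality almost everywhere: both the membership
  and the integrals below depend on \<open>f\<close> only up to a Lebesgue null set.\<close>

definition frac_sobolev :: "real \<Rightarrow> (real ^ 'n::finite \<Rightarrow> real) set" where
  "frac_sobolev \<alpha> = {f. integrable lebesgue f \<and> frac_seminorm \<alpha> f < \<infinity>}"

text \<open>The value \<open>0\<close> that division by zero gives the integrand at \<open>y = x\<close> is immaterial.
  For \<open>0 < \<alpha> < 1\<close> and \<open>f \<in> frac_sobolev \<alpha>\<close> the integral converges
  absolutely for almost every \<open>x\<close>; elsewhere the Bochner integral is \<open>0\<close> by convention.\<close>

definition frac_gradient :: "real \<Rightarrow> (real ^ 'n::finite \<Rightarrow> real) \<Rightarrow> real ^ 'n \<Rightarrow> real ^ 'n" where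
  "frac_gradient \<alpha> f x =
     frac_const CARD('n) \<alpha> *\<^sub>R
       (\<integral> y. ((f y - f x) / norm (y - x) powr (real CARD('n) + \<alpha> + 1)) *\<^sub>R (y - x) \<partial>lebesgue)"

end

theory Submission
  imports Defs "HOL-Real_Asymp.Real_Asymp"
begin

text \<open>Split the integral defining \<open>\<nabla>\<^sup>\<alpha> f(x)\<close> at \<open>|y - x| = 1\<close>. The near part has
  \<open>L\<^sup>1\<close> norm at most the seminorm of order \<open>\<alpha>\<^sub>0\<close>, uniformly in \<open>\<alpha> \<le> \<alpha>\<^sub>0\<close>, so it vanishes after
  multiplication by \<open>\<alpha>\<close>. In the far part the term with \<open>f(x)\<close> drops out because the kernel is odd,
  which leaves the convolution of \<open>f\<close> with a kernel \<open>k\<close> of \<open>L\<^sup>1\<close> norm \<open>n \<omega>\<^sub>n / \<alpha>\<close>. Translating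
  \<open>k\<close> by a fixed \<open>y\<close> changes it by an amount bounded in \<open>L\<^sup>1\<close> uniformly in \<open>\<alpha>\<close>, hence by
  dominated convergence the convolution may be replaced by \<open>(\<integral> f) k\<close> up to an error of
  \<open>L\<^sup>1\<close> norm \<open>o(1/\<alpha>)\<close>.\<close>

section \<open>Reflections of Lebesgue measure and the mass of a power tail\<close>

lemma lborel_distr_reflect:
  fixes t :: "'a::euclidean_space"
  shows "distr lborel borel (\<lambda>u. t - u) = lborel"
proof -
  have "lborel = density (distr lborel borel (\<lambda>x. t + (-1) *\<^sub>R x)) (\<lambda>_. \<bar>-1::real\<bar>^DIM('a))"
    by (rule lborel_affine) simp
  then show ?thesis by (simp add: density_1)
qed

lemma nn_integral_lborel_reflect:
  fixes t :: "'a::euclidean_space"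
  assumes [measurable]: "f \<in> borel_measurable borel"
  shows "(\<integral>\<^sup>+ u. f (t - u) \<partial>lborel) = (\<integral>\<^sup>+ u. f u \<partial>lborel)"
  by (subst (2) lborel_distr_reflect[of t, symmetric]) (simp add: nn_integral_distr)

lemma integral_lborel_reflect:
  fixes t :: "'a::euclidean_space" and f :: "'a \<Rightarrow> 'b::{banach, second_countable_topology}"
  assumes [measurable]: "f \<in> borel_measurable borel"
  shows "(\<integral> u. f (t - u) \<partial>lborel) = (\<integral> u. f u \<partial>lborel)"
  by (subst (2) lborel_distr_reflect[of t, symmetric]) (simp add: integral_distr)

text \<open>Writing \<open>|z|\<^bsup>-p\<^esup>\<close> as the integral of \<open>p t\<^bsup>-p-1\<^esup>\<close> over \<open>t \<ge> |z|\<close> reduces the claim to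
  volumes of balls, so that no polar coordinates are needed.\<close>

lemma nn_integral_norm_powr_tail:
  assumes a: "0 < a"
  shows "(\<integral>\<^sup>+ z. ennreal (if 1 \<le> norm (z::'a::euclidean_space) then norm z powr - (real DIM('a) + a) else 0) \<partial>lborel)
    = ennreal (real DIM('a) * unit_ball_vol (real DIM('a)) / a)"
proof -
  define n where "n = real DIM('a)"
  define p where "p = n + a"
  define w where "w = unit_ball_vol n"
  have n: "n \<ge> 1" using DIM_positive[where 'a='a] by (simp add: n_def del: DIM_positive)
  have p: "p > 0" using n a by (simp add: p_def)
  have w: "w \<ge> 0" by (simp add: w_def n_def)
  have 1: "ennreal (if 1 \<le> norm z then norm z powr - p else 0)
    = (\<integral>\<^sup>+ t. ennreal (p * t powr (-p-1)) * (indicator {1..t} (norm z)) \<partial>lborel)" for z :: 'a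
  proof (cases "1 \<le> norm z")
    case True
    have "(\<integral>\<^sup>+ t. ennreal (p * t powr (-p-1)) * indicator {norm z..} t \<partial>lborel)
      = ennreal (0 - (- (norm z powr - p)))"
    proof (rule nn_integral_FTC_atLeast)
      show "((\<lambda>t. - (t powr - p)) \<longlongrightarrow> 0) at_top"
        using p by real_asymp
    qed (use True p in \<open>auto intro!: derivative_eq_intros\<close>)
    also have "(\<integral>\<^sup>+ t. ennreal (p * t powr (-p-1)) * indicator {norm z..} t \<partial>lborel)
      = (\<integral>\<^sup>+ t. ennreal (p * t powr (-p-1)) * (indicator {1..t} (norm z)) \<partial>lborel)"
      using True by (intro nn_integral_cong) (auto simp: indicator_def)
    finally show ?thesis using True by simp
  qed (auto simp: indicator_def)
  have [measurable]: "(\<lambda>(z::'a, t). indicator {1..t} (norm z) :: ennreal) \<in> borel_measurable (lborel \<Otimes>\<^sub>M lborel)"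
  proof -
    have "(\<lambda>(z::'a, t). indicator {1..t} (norm z) :: ennreal) = indicator {x. 1 \<le> norm (fst x) \<and> norm (fst x) \<le> snd x}"
      by (auto simp: indicator_def fun_eq_iff)
    then show ?thesis by simp
  qed
  \<comment> \<open>For fixed \<open>t\<close> the admissible \<open>z\<close> form the shell 1 <=
    |z| <= t, a closed ball minus an open one.\<close>
  have vol: "(\<integral>\<^sup>+ (z::'a). indicator {1..t} (norm z) \<partial>lborel) = ennreal (w * (t powr n - 1))" if "t \<ge> 1" for t
  proof -
    have "(\<integral>\<^sup>+ (z::'a). indicator {1..t} (norm z) \<partial>lborel) = (\<integral>\<^sup>+ (z::'a). indicator (cball 0 t - ball 0 1) z \<partial>lborel)"
      by (intro nn_integral_cong) (auto simp: indicator_def)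
    also have "\<dots> = emeasure lborel (cball (0::'a) t - ball 0 1)"
      by (rule nn_integral_indicator) simp
    also have "\<dots> = emeasure lborel (cball (0::'a) t) - emeasure lborel (ball (0::'a) 1)"
      using that by (intro emeasure_Diff) (auto simp: emeasure_ball)
    also have "\<dots> = ennreal (w * (t powr n - 1))"
      using that w by (simp add: emeasure_ball emeasure_cball w_def n_def powr_realpow ennreal_minus algebra_simps)
    finally show ?thesis .
  qed
  have "(\<integral>\<^sup>+ (z::'a). ennreal (if 1 \<le> norm z then norm z powr - p else 0) \<partial>lborel) =
     (\<integral>\<^sup>+ t. (\<integral>\<^sup>+ (z::'a). ennreal (p * t powr (-p-1)) * (indicator {1..t} (norm z)) \<partial>lborel) \<partial>lborel)"
    unfolding 1 by (rule lborel_pair.Fubini') measurable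
  also have "\<dots> = (\<integral>\<^sup>+ t. ennreal (p * t powr (-p-1)) * (\<integral>\<^sup>+ (z::'a). (indicator {1..t} (norm z)) \<partial>lborel) \<partial>lborel)"
    by (intro nn_integral_cong nn_integral_cmult) measurable
  also have "\<dots> = (\<integral>\<^sup>+ t. ennreal (w * p * (t powr (-a-1) - t powr (-p-1))) * indicator {1..} t \<partial>lborel)"
  proof (intro nn_integral_cong)
    fix t :: real
    show "ennreal (p * t powr (-p-1)) * (\<integral>\<^sup>+ (z::'a). (indicator {1..t} (norm z)) \<partial>lborel)
      = ennreal (w * p * (t powr (-a-1) - t powr (-p-1))) * indicator {1..} t"
    proof (cases "t \<ge> 1")
      case True
      have "t powr (-a-1) = t powr (-p-1) * t powr n"
        by (simp add: p_def flip: powr_add)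
      moreover have "ennreal (p * t powr (-p-1)) * ennreal (w * (t powr n - 1))
        = ennreal (p * t powr (-p-1) * (w * (t powr n - 1)))"
        using True p w n by (intro ennreal_mult[symmetric] mult_nonneg_nonneg) (auto intro: ge_one_powr_ge_zero)
      ultimately show ?thesis using True
        by (simp add: vol algebra_simps)
    next
      case False
      then have "(\<integral>\<^sup>+ (z::'a). (indicator {1..t} (norm z)) \<partial>lborel) = 0"
        by (simp add: indicator_def)
      then show ?thesis using False by simp
    qed
  qed
  \<comment> \<open>The antiderivative w (t^(-p) - (p/a) t^(-a)) vanishes at infinity and, because p
    = n + a, equals -n w / a at t = 1.\<close>
  also have "\<dots> = ennreal (0 - w * (1 powr (-p) - p / a * 1 powr (-a)))"
  proof (rule nn_integral_FTC_atLeast)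
    show "((\<lambda>t. w * (t powr (-p) - p / a * t powr (-a))) \<longlongrightarrow> 0) at_top"
    proof -
      have l: "((\<lambda>t::real. t powr (-p)) \<longlongrightarrow> 0) at_top" "((\<lambda>t::real. t powr (-a)) \<longlongrightarrow> 0) at_top"
        using p a by real_asymp+
      show ?thesis
        using tendsto_mult[OF tendsto_const[of w] tendsto_diff[OF l(1) tendsto_mult[OF tendsto_const[of "p / a"] l(2)]]]
        by simp
    qed
    show "0 \<le> w * p * (x powr (- a - 1) - x powr (- p - 1))" if "1 \<le> x" for x
      using that w p n by (intro mult_nonneg_nonneg) (auto simp: p_def intro!: powr_mono)
    show "((\<lambda>t. w * (t powr (-p) - p / a * t powr (-a))) has_real_derivative w * p * (x powr (- a - 1) - x powr (- p - 1))) (at x)"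
      if "1 \<le> x" for x
      using that a by (auto intro!: derivative_eq_intros simp: field_simps)
  qed auto
  also have "0 - w * (1 powr (-p) - p / a * 1 powr (-a)) = n * w / a"
    using a by (simp add: p_def field_simps)
  finally show ?thesis unfolding p_def w_def n_def .
qed

section \<open>The kernel truncated to the outside of the unit ball\<close>

definition far_kernel :: "real \<Rightarrow> 'a::euclidean_space \<Rightarrow> 'a" where
  "far_kernel a z = (if 1 \<le> norm z then (1 / norm z powr (real DIM('a) + a + 1)) *\<^sub>R z else 0)"

lemma far_kernel_measurable [measurable]: "far_kernel a \<in> borel_measurable borel"
  unfolding far_kernel_def by measurable

lemma far_kernel_minus: "far_kernel a (- z) = - far_kernel a z"
  by (simp add: far_kernel_def)

lemma norm_far_kernel:
  fixes z :: "'a::euclidean_space"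
  shows "norm (far_kernel a z) = (if 1 \<le> norm z then norm z powr - (real DIM('a) + a) else 0)"
proof (cases "1 \<le> norm z")
  case True
  have "norm z powr (real DIM('a) + a + 1) = norm z powr (real DIM('a) + a) * norm z"
    using True by (simp add: powr_add)
  then show ?thesis
    using True powr_minus_divide[of "norm z" "real DIM('a) + a"] by (auto simp: far_kernel_def)
qed (simp add: far_kernel_def)

text \<open>The cut removes the singularity. Boundedness makes the product with an integrable
  function integrable, so that later the terms with \<open>g y\<close> and with \<open>g x\<close>
  can be integrated separately.\<close>

lemma norm_far_kernel_le_1:
  fixes z :: "'a::euclidean_space"
  assumes "0 \<le> a"
  shows "norm (far_kernel a z) \<le> 1"
proof (cases "1 \<le> norm z")
  case True
  have "norm z powr - (real DIM('a) + a) \<le> norm z powr 0"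
    using True assms by (intro powr_mono) auto
  then show ?thesis using True by (auto simp: norm_far_kernel split: if_splits)
qed (simp add: norm_far_kernel)

lemma nn_integral_norm_far_kernel:
  fixes x :: "'a::euclidean_space"
  assumes "0 < a"
  shows "(\<integral>\<^sup>+ z. ennreal (norm (far_kernel a (x - z))) \<partial>lborel)
    = ennreal (real DIM('a) * unit_ball_vol (real DIM('a)) / a)"
  using nn_integral_lborel_reflect[of "\<lambda>z. ennreal (norm (far_kernel a z))" x]
    nn_integral_norm_powr_tail[OF assms, where 'a='a]
  by (simp add: norm_far_kernel)

lemma integrable_far_kernel:
  fixes x :: "'a::euclidean_space"
  assumes "0 < a"
  shows "integrable lborel (\<lambda>z. far_kernel a (x - z))"
  using nn_integral_norm_far_kernel[OF assms, of x]
  by (intro integrableI_bounded) auto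

lemma integral_norm_far_kernel:
  fixes x :: "'a::euclidean_space"
  assumes "0 < a"
  shows "(\<integral> z. norm (far_kernel a (x - z)) \<partial>lborel) = real DIM('a) * unit_ball_vol (real DIM('a)) / a"
  using nn_integral_norm_far_kernel[OF assms, of x] assms
  by (subst integral_eq_nn_integral) auto

text \<open>Reflection invariance and oddness make the integral its own negative. This cancellation
  removes the value \<open>g x\<close> from the far part.\<close>

lemma integral_far_kernel_eq_0:
  fixes x :: "'a::euclidean_space"
  shows "(\<integral> z. far_kernel a (x - z) \<partial>lborel) = 0"
proof -
  have "(\<integral> z. far_kernel a (x - z) \<partial>lborel) = (\<integral> z. far_kernel a (0 - z) \<partial>lborel)"
    by (simp only: integral_lborel_reflect[OF far_kernel_measurable])
  also have "\<dots> = - (\<integral> z. far_kernel a z \<partial>lborel)"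
    by (simp add: far_kernel_minus)
  also have "(\<integral> z. far_kernel a z \<partial>lborel) = (\<integral> z. far_kernel a (x - z) \<partial>lborel)"
    by (simp add: integral_lborel_reflect[of "far_kernel a" x])
  finally have "2 *\<^sub>R (\<integral> z. far_kernel a (x - z) \<partial>lborel) = 0"
    by (metis add.right_inverse scaleR_2)
  then show ?thesis by simp
qed

section \<open>Translating the kernel: bounds in L^1\<close>

lemma powr_minus_diff_le:
  fixes x y c s :: real
  assumes c: "0 < c" and x: "c \<le> x" and y: "c \<le> y" and s: "0 \<le> s"
  shows "\<bar>x powr - s - y powr - s\<bar> \<le> s * c powr (- s - 1) * \<bar>x - y\<bar>"
proof -
  have "norm (x powr - s - y powr - s) \<le> (s * c powr (- s - 1)) * norm (x - y)"
  proof (rule field_differentiable_bound[where S="{c..}" and f'="\<lambda>t. - s * t powr (- s - 1)"])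
    \<comment> \<open>The size of the derivative decreases in \<open>t\<close>, so its value at the
      left end \<open>c\<close> bounds it.\<close>
    show "norm (- s * t powr (- s - 1)) \<le> s * c powr (- s - 1)" if "t \<in> {c..}" for t
      using that c s by (auto simp: abs_mult intro!: mult_left_mono powr_mono2')
    show "((\<lambda>t. t powr - s) has_field_derivative - s * t powr (- s - 1)) (at t within {c..})" if "t \<in> {c..}" for t
      using that c by (auto intro!: derivative_eq_intros)
  qed (use x y in auto)
  then show ?thesis by simp
qed

text \<open>A translation gains one power of decay: the difference is of order |y| |b|^(-n-a-1),
  which is integrable at infinity uniformly in \<open>a\<close>. The threshold on |b| keeps both
  points outside the unit ball and |y + b| between |b|/2 and 3|b|/2.\<close>

lemma far_kernel_diff_le:
  fixes b y :: "'a::euclidean_space"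
  assumes a: "0 \<le> a" "a \<le> 1" and b: "2 * norm y + 2 \<le> norm b"
  defines "n \<equiv> real DIM('a)"
  shows "norm (far_kernel a (y + b) - far_kernel a b)
    \<le> (1 + 3 * (n + 2) * 2 powr (n + 2)) * norm y * norm b powr - (n + 1)"
proof -
  define s where "s = n + a + 1"
  have n: "n \<ge> 1" using DIM_positive[where 'a='a] by (simp add: n_def del: DIM_positive)
  have s: "n + 1 \<le> s" "s \<le> n + 2" using a by (auto simp: s_def)
  have b1: "1 \<le> norm b" using b norm_ge_zero[of y] by linarith
  have yb: "norm b / 2 \<le> norm (y + b)"
    using norm_triangle_ineq4[of "y + b" y] b by simp
  have yb2: "norm (y + b) \<le> 3 / 2 * norm b"
    using norm_triangle_ineq[of y b] b by simp
  have yb1: "1 \<le> norm (y + b)" using yb b norm_ge_zero[of y] by linarith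
  have ybb: "\<bar>norm (y + b) - norm b\<bar> \<le> norm y"
    using norm_triangle_ineq3[of "y + b" b] by simp
  have k: "far_kernel a z = (norm z powr - s) *\<^sub>R z" if "1 \<le> norm z" for z :: 'a
    using that by (simp only: far_kernel_def if_True s_def n_def powr_minus_divide)
  \<comment> \<open>Adding and subtracting |b|^(-s) (y + b) separates the change of the vector from
    the change of its radial weight.\<close>
  have "far_kernel a (y + b) - far_kernel a b
    = (norm b powr - s) *\<^sub>R y + (norm (y + b) powr - s - norm b powr - s) *\<^sub>R (y + b)"
    using b1 yb1 by (simp add: k algebra_simps)
  also have "norm \<dots> \<le> norm b powr - s * norm y + \<bar>norm (y + b) powr - s - norm b powr - s\<bar> * norm (y + b)"
    by (rule order.trans[OF norm_triangle_ineq]) simp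
  also have "\<dots> \<le> norm b powr - s * norm y + (s * (norm b / 2) powr (- s - 1) * norm y) * (3 / 2 * norm b)"
  proof (intro add_mono mult_mono order.refl yb2)
    have "\<bar>norm (y + b) powr - s - norm b powr - s\<bar>
      \<le> s * (norm b / 2) powr (- s - 1) * \<bar>norm (y + b) - norm b\<bar>"
      using b1 yb s n by (intro powr_minus_diff_le) auto
    also have "\<dots> \<le> s * (norm b / 2) powr (- s - 1) * norm y"
      using ybb s n by (intro mult_left_mono) auto
    finally show "\<bar>norm (y + b) powr - s - norm b powr - s\<bar> \<le> s * (norm b / 2) powr (- s - 1) * norm y" .
  qed (use s n in auto)
  also have "(norm b / 2) powr (- s - 1) = norm b powr - s * 2 powr s * (2 / norm b)"
  proof -
    have "(norm b / 2) powr (- s - 1) = (norm b / 2) powr - s / (norm b / 2)"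
      using b1 by (simp add: powr_diff)
    also have "(norm b / 2) powr - s = norm b powr - s * 2 powr s"
      by (simp add: powr_divide powr_minus divide_simps)
    finally show ?thesis by simp
  qed
  also have "norm b powr - s * norm y + (s * (norm b powr - s * 2 powr s * (2 / norm b)) * norm y) * (3 / 2 * norm b)
    = (1 + 3 * s * 2 powr s) * norm y * norm b powr - s"
    using b1 by (auto simp: field_simps)
  \<comment> \<open>The factor 3 arose from (2/|b|) (3|b|/2). Since n + 1 <= s <= n + 2 and |b| >=
    1, the dependence on \<open>a\<close> can now be dropped.\<close>
  also have "\<dots> \<le> (1 + 3 * (n + 2) * 2 powr (n + 2)) * norm y * norm b powr - (n + 1)"
    using s n b1 by (intro mult_mono add_mono order.refl powr_mono) auto
  finally show ?thesis .
qed

text \<open>The two summands come from splitting at radius 2|y| + 2. Inside that ball the two kernel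
  values differ by at most 2; outside, the decay estimate is integrated with the tail formula for
  exponent n + 1, that is, for a = 1.\<close>

definition far_kernel_bound :: "'a::euclidean_space \<Rightarrow> real" where
  "far_kernel_bound y =
    2 * (unit_ball_vol (real DIM('a)) * (2 * norm y + 2) ^ DIM('a)) +
    (1 + 3 * (real DIM('a) + 2) * 2 powr (real DIM('a) + 2)) * norm y *
      (real DIM('a) * unit_ball_vol (real DIM('a)))"

lemma far_kernel_bound_measurable [measurable]: "far_kernel_bound \<in> borel_measurable borel"
  unfolding far_kernel_bound_def by measurable

lemma far_kernel_bound_nonneg: "0 \<le> far_kernel_bound y"
  unfolding far_kernel_bound_def by (intro add_nonneg_nonneg mult_nonneg_nonneg zero_le_power) auto

lemma nn_integral_far_kernel_diff_le_bound:
  fixes y :: "'a::euclidean_space"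
  assumes a: "0 \<le> a" "a \<le> 1"
  shows "(\<integral>\<^sup>+ x. ennreal (norm (far_kernel a (y - x) - far_kernel a (- x))) \<partial>lborel)
    \<le> ennreal (far_kernel_bound y)"
proof -
  define R where "R = 2 * norm y + 2"
  define M where "M = 1 + 3 * (real DIM('a) + 2) * 2 powr (real DIM('a) + 2)"
  have M: "0 \<le> M" and R: "0 \<le> R" by (auto simp: M_def R_def)
  have R1: "1 \<le> R" using norm_ge_zero[of y] unfolding R_def by linarith
  let ?t = "\<lambda>b::'a. if 1 \<le> norm b then norm b powr - (real DIM('a) + 1) else 0"
  have [measurable]: "?t \<in> borel_measurable borel"
    unfolding norm_far_kernel[of 1, symmetric] by measurable
  have "(\<integral>\<^sup>+ x. ennreal (norm (far_kernel a (y - x) - far_kernel a (- x))) \<partial>lborel)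
    = (\<integral>\<^sup>+ b. ennreal (norm (far_kernel a (y + b) - far_kernel a b)) \<partial>lborel)"
    using nn_integral_lborel_reflect[of "\<lambda>b. ennreal (norm (far_kernel a (y + b) - far_kernel a b))" 0] by simp
  also have "\<dots> \<le> (\<integral>\<^sup>+ b. 2 * indicator (ball 0 R) b + ennreal (M * norm y) * ennreal (?t b) \<partial>lborel)"
  proof (intro nn_integral_mono)
    fix b :: 'a
    show "ennreal (norm (far_kernel a (y + b) - far_kernel a b))
      \<le> 2 * indicator (ball 0 R) b + ennreal (M * norm y) * ennreal (?t b)"
    proof (cases "norm b < R")
      case True
      have "norm (far_kernel a (y + b) - far_kernel a b) \<le> 2"
        using norm_triangle_ineq4[of "far_kernel a (y + b)" "far_kernel a b"]
          norm_far_kernel_le_1[OF a(1), of "y + b"] norm_far_kernel_le_1[OF a(1), of b] by linarith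
      then have "ennreal (norm (far_kernel a (y + b) - far_kernel a b)) \<le> 2"
        by (metis ennreal_leI ennreal_numeral)
      then show ?thesis using True by (simp add: add_increasing2)
    next
      case False
      then have "1 \<le> norm b" using R1 by linarith
      with False have "norm (far_kernel a (y + b) - far_kernel a b) \<le> M * norm y * ?t b"
        using far_kernel_diff_le[OF a, of y b] R1 by (simp add: M_def R_def)
      then have "ennreal (norm (far_kernel a (y + b) - far_kernel a b)) \<le> ennreal (M * norm y) * ennreal (?t b)"
        using M by (simp add: ennreal_leI flip: ennreal_mult)
      then show ?thesis by (simp add: add_increasing)
    qed
  qed
  also have "\<dots> = (\<integral>\<^sup>+ b. 2 * indicator (ball (0::'a) R) b \<partial>lborel) + (\<integral>\<^sup>+ b. ennreal (M * norm y) * ennreal (?t b) \<partial>lborel)"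
    by (rule nn_integral_add) (auto intro!: borel_measurable_times_ennreal borel_measurable_indicator)
  also have "\<dots> = 2 * emeasure lborel (ball (0::'a) R) + ennreal (M * norm y) * (\<integral>\<^sup>+ b. ennreal (?t b) \<partial>lborel)"
    by (simp add: nn_integral_cmult nn_integral_cmult_indicator)
  also have "\<dots> = ennreal 2 * ennreal (unit_ball_vol (real DIM('a)) * R ^ DIM('a))
      + ennreal (M * norm y) * ennreal (real DIM('a) * unit_ball_vol (real DIM('a)))"
    using nn_integral_norm_powr_tail[of 1, where 'a='a] R by (simp add: emeasure_ball)
  also have "\<dots> = ennreal (far_kernel_bound y)"
    unfolding far_kernel_bound_def R_def[symmetric] M_def[symmetric]
    using M R by (subst ennreal_plus, simp, simp, subst (1 2) ennreal_mult, simp_all)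
  finally show ?thesis .
qed

text \<open>The triangle inequality gives a bound that is worse in \<open>a\<close> but uniform in
  \<open>y\<close>. It is needed because \<open>far_kernel_bound\<close> grows with |y| and
  \<open>g\<close> is merely integrable: this bound will supply the dominating function.\<close>

lemma nn_integral_far_kernel_diff_le_mass:
  fixes y :: "'a::euclidean_space"
  assumes a: "0 < a"
  shows "(\<integral>\<^sup>+ x. ennreal (norm (far_kernel a (y - x) - far_kernel a (- x))) \<partial>lborel)
    \<le> ennreal (2 * (real DIM('a) * unit_ball_vol (real DIM('a))) / a)"
proof -
  have "(\<integral>\<^sup>+ x. ennreal (norm (far_kernel a (y - x) - far_kernel a (- x))) \<partial>lborel)
    \<le> (\<integral>\<^sup>+ x. ennreal (norm (far_kernel a (y - x))) + ennreal (norm (far_kernel a (0 - x))) \<partial>lborel)"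
    by (intro nn_integral_mono) (auto simp: norm_triangle_ineq4 intro!: ennreal_leI simp flip: ennreal_plus)
  also have "\<dots> = (\<integral>\<^sup>+ x. ennreal (norm (far_kernel a (y - x))) \<partial>lborel)
    + (\<integral>\<^sup>+ x. ennreal (norm (far_kernel a ((0::'a) - x))) \<partial>lborel)"
    by (simp add: nn_integral_add)
  also have "\<dots> = ennreal (2 * (real DIM('a) * unit_ball_vol (real DIM('a))) / a)"
    unfolding nn_integral_norm_far_kernel[OF a] using a by (simp add: flip: ennreal_plus)
  finally show ?thesis .
qed

section \<open>Comparing the singular integral with a multiple of the kernel\<close>

definition riesz_integral :: "real \<Rightarrow> ('a::euclidean_space \<Rightarrow> real) \<Rightarrow> 'a \<Rightarrow> 'a" where
  "riesz_integral a g x =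
    (\<integral> y. ((g y - g x) / norm (y - x) powr (real DIM('a) + a + 1)) *\<^sub>R (y - x) \<partial>lborel)"

text \<open>The inner integral of the Gagliardo seminorm. Its finiteness at \<open>x\<close> is what
  makes the near part of the singular integral converge at \<open>x\<close>.\<close>

definition gagliardo_slice :: "real \<Rightarrow> ('a::euclidean_space \<Rightarrow> real) \<Rightarrow> 'a \<Rightarrow> ennreal" where
  "gagliardo_slice a g x =
    (\<integral>\<^sup>+ y. ennreal (\<bar>g y - g x\<bar> / norm (y - x) powr (real DIM('a) + a)) \<partial>lborel)"

lemma riesz_integral_measurable [measurable]:
  fixes g :: "'a::euclidean_space \<Rightarrow> real"
  assumes [measurable]: "g \<in> borel_measurable borel"
  shows "riesz_integral a g \<in> borel_measurable borel"
  unfolding riesz_integral_def by measurable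

lemma gagliardo_slice_measurable [measurable]:
  fixes g :: "'a::euclidean_space \<Rightarrow> real"
  assumes [measurable]: "g \<in> borel_measurable borel"
  shows "gagliardo_slice a g \<in> borel_measurable borel"
  unfolding gagliardo_slice_def by measurable

text \<open>Near \<open>x\<close> the kernel of order \<open>a\<close> is dominated by that of order
  \<open>a0\<close>, which gives the first term. Away from \<open>x\<close> only the convolution of
  \<open>g\<close> with the kernel remains, and the second term measures the cost of moving all the
  mass of \<open>g\<close> to the origin.\<close>

lemma riesz_integral_approx:
  fixes g :: "'a::euclidean_space \<Rightarrow> real"
  assumes g: "integrable lborel g"
    and a: "0 < a" "a \<le> a0" and fin: "gagliardo_slice a0 g x < \<infinity>"
  shows "ennreal (norm (riesz_integral a g x - (\<integral> y. g y \<partial>lborel) *\<^sub>R far_kernel a (- x)))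
    \<le> gagliardo_slice a0 g x
      + (\<integral>\<^sup>+ y. ennreal (\<bar>g y\<bar> * norm (far_kernel a (y - x) - far_kernel a (- x))) \<partial>lborel)"
proof -
  have [measurable]: "g \<in> borel_measurable borel" using g by auto
  define near where "near y = (if norm (y - x) < 1
    then ((g y - g x) / norm (y - x) powr (real DIM('a) + a + 1)) *\<^sub>R (y - x) else 0)" for y
  have [measurable]: "near \<in> borel_measurable borel"
    unfolding near_def by measurable
  have near_le: "(\<integral>\<^sup>+ y. ennreal (norm (near y)) \<partial>lborel) \<le> gagliardo_slice a0 g x"
    unfolding gagliardo_slice_def
  proof (intro nn_integral_mono ennreal_leI)
    fix y
    show "norm (near y) \<le> \<bar>g y - g x\<bar> / norm (y - x) powr (real DIM('a) + a0)"
    proof (cases "norm (y - x) < 1 \<and> y \<noteq> x")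
      case True
      then have "norm (near y) = \<bar>g y - g x\<bar> / norm (y - x) powr (real DIM('a) + a)"
        by (simp add: near_def powr_add)
      \<comment> \<open>Here |y - x| < 1, so raising the exponent from \<open>a\<close> to
        \<open>a0\<close> decreases the denominator.\<close>
      also have "\<dots> \<le> \<bar>g y - g x\<bar> / norm (y - x) powr (real DIM('a) + a0)"
        using True a by (intro divide_left_mono powr_mono') auto
      finally show ?thesis .
    qed (auto simp: near_def)
  qed
  have near_int: "integrable lborel near"
    using near_le fin by (intro integrableI_bounded) (auto simp: less_top intro: le_less_trans)
  have far_eq: "far_kernel a (y - x) = - far_kernel a (x - y)" for y
    by (metis far_kernel_minus minus_diff_eq)
  have far0: "integrable lborel (\<lambda>y. far_kernel a (y - x))" "(\<integral> y. far_kernel a (y - x) \<partial>lborel) = 0"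
    unfolding far_eq using integrable_far_kernel[OF a(1), of x] integral_far_kernel_eq_0[of a x] by auto
  have far1: "integrable lborel (\<lambda>y. g y *\<^sub>R far_kernel a (y - x))"
  proof (rule Bochner_Integration.integrable_bound[OF g])
    show "AE y in lborel. norm (g y *\<^sub>R far_kernel a (y - x)) \<le> norm (g y)"
      using norm_far_kernel_le_1[of a] a by (auto intro!: AE_I2 mult_left_le)
  qed auto
  have split: "((g y - g x) / norm (y - x) powr (real DIM('a) + a + 1)) *\<^sub>R (y - x)
      = near y + (g y *\<^sub>R far_kernel a (y - x) - g x *\<^sub>R far_kernel a (y - x))" for y
    by (auto simp: near_def far_kernel_def diff_divide_distrib scaleR_diff_left)
  have "riesz_integral a g x = (\<integral> y. near y \<partial>lborel) + (\<integral> y. g y *\<^sub>R far_kernel a (y - x) \<partial>lborel)"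
    unfolding riesz_integral_def split using near_int far0 far1 by simp
  \<comment> \<open>The vector \<open>far_kernel a (- x)\<close> is constant in \<open>y\<close>, so
    its multiple by the integral of \<open>g\<close> is itself an integral against
    \<open>g\<close>.\<close>
  moreover have "(\<integral> y. g y *\<^sub>R far_kernel a (y - x) \<partial>lborel) - (\<integral> y. g y \<partial>lborel) *\<^sub>R far_kernel a (- x)
      = (\<integral> y. g y *\<^sub>R (far_kernel a (y - x) - far_kernel a (- x)) \<partial>lborel)"
    using far1 g by (simp add: scaleR_diff_right)
  ultimately have "riesz_integral a g x - (\<integral> y. g y \<partial>lborel) *\<^sub>R far_kernel a (- x)
    = (\<integral> y. near y \<partial>lborel) + (\<integral> y. g y *\<^sub>R (far_kernel a (y - x) - far_kernel a (- x)) \<partial>lborel)"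
    by (simp add: algebra_simps)
  then have "ennreal (norm (riesz_integral a g x - (\<integral> y. g y \<partial>lborel) *\<^sub>R far_kernel a (- x)))
    \<le> ennreal (norm (\<integral> y. near y \<partial>lborel))
      + ennreal (norm (\<integral> y. g y *\<^sub>R (far_kernel a (y - x) - far_kernel a (- x)) \<partial>lborel))"
    by (simp add: norm_triangle_ineq ennreal_leI flip: ennreal_plus)
  also have "\<dots> \<le> (\<integral>\<^sup>+ y. ennreal (norm (near y)) \<partial>lborel)
      + (\<integral>\<^sup>+ y. ennreal (norm (g y *\<^sub>R (far_kernel a (y - x) - far_kernel a (- x)))) \<partial>lborel)"
    using near_int far1 g
    by (intro add_mono integral_norm_bound_ennreal) (auto simp: scaleR_diff_right)
  also have "\<dots> \<le> gagliardo_slice a0 g x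
      + (\<integral>\<^sup>+ y. ennreal (\<bar>g y\<bar> * norm (far_kernel a (y - x) - far_kernel a (- x))) \<partial>lborel)"
    using near_le by (intro add_mono) auto
  finally show ?thesis .
qed

text \<open>The pointwise estimate is integrated in \<open>x\<close>. After exchanging the
  integrals, each fixed \<open>y\<close> contributes an L^1 distance between translates of the
  kernel, for which the smaller of the two bounds is used.\<close>

lemma nn_integral_riesz_integral_approx:
  fixes g :: "'a::euclidean_space \<Rightarrow> real"
  assumes g: "integrable lborel g"
    and a: "0 < a" "a \<le> a0" "a0 \<le> 1" and fin: "(\<integral>\<^sup>+ x. gagliardo_slice a0 g x \<partial>lborel) < \<infinity>"
  shows "(\<integral>\<^sup>+ x. ennreal (norm (riesz_integral a g x - (\<integral> y. g y \<partial>lborel) *\<^sub>R far_kernel a (- x))) \<partial>lborel)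
    \<le> (\<integral>\<^sup>+ x. gagliardo_slice a0 g x \<partial>lborel)
      + (\<integral>\<^sup>+ y. ennreal (\<bar>g y\<bar> * min (2 * (real DIM('a) * unit_ball_vol (real DIM('a))) / a) (far_kernel_bound y)) \<partial>lborel)"
proof -
  have [measurable]: "g \<in> borel_measurable borel" using g by auto
  have fin_ae: "AE x in lborel. gagliardo_slice a0 g x < \<infinity>"
    using nn_integral_PInf_AE[of "gagliardo_slice a0 g" lborel] fin by (auto simp: less_top)
  have "(\<integral>\<^sup>+ x. ennreal (norm (riesz_integral a g x - (\<integral> y. g y \<partial>lborel) *\<^sub>R far_kernel a (- x))) \<partial>lborel)
    \<le> (\<integral>\<^sup>+ x. gagliardo_slice a0 g x
      + (\<integral>\<^sup>+ y. ennreal (\<bar>g y\<bar> * norm (far_kernel a (y - x) - far_kernel a (- x))) \<partial>lborel) \<partial>lborel)"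
  proof (rule nn_integral_mono_AE)
    show "AE x in lborel. ennreal (norm (riesz_integral a g x - (\<integral> y. g y \<partial>lborel) *\<^sub>R far_kernel a (- x)))
      \<le> gagliardo_slice a0 g x
        + (\<integral>\<^sup>+ y. ennreal (\<bar>g y\<bar> * norm (far_kernel a (y - x) - far_kernel a (- x))) \<partial>lborel)"
      using fin_ae by eventually_elim (rule riesz_integral_approx[OF g a(1,2)])
  qed
  also have "\<dots> = (\<integral>\<^sup>+ x. gagliardo_slice a0 g x \<partial>lborel)
      + (\<integral>\<^sup>+ x. (\<integral>\<^sup>+ y. ennreal (\<bar>g y\<bar> * norm (far_kernel a (y - x) - far_kernel a (- x))) \<partial>lborel) \<partial>lborel)"
    by (rule nn_integral_add) measurable
  also have "(\<integral>\<^sup>+ x. (\<integral>\<^sup>+ y. ennreal (\<bar>g y\<bar> * norm (far_kernel a (y - x) - far_kernel a (- x))) \<partial>lborel) \<partial>lborel)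
    = (\<integral>\<^sup>+ y. (\<integral>\<^sup>+ x. ennreal (\<bar>g y\<bar> * norm (far_kernel a (y - x) - far_kernel a (- x))) \<partial>lborel) \<partial>lborel)"
    by (rule lborel_pair.Fubini') measurable
  also have "\<dots> \<le> (\<integral>\<^sup>+ y. ennreal (\<bar>g y\<bar> * min (2 * (real DIM('a) * unit_ball_vol (real DIM('a))) / a) (far_kernel_bound y)) \<partial>lborel)"
  proof (intro nn_integral_mono)
    fix y :: 'a
    have "(\<integral>\<^sup>+ x. ennreal (norm (far_kernel a (y - x) - far_kernel a (- x))) \<partial>lborel)
      \<le> ennreal (min (2 * (real DIM('a) * unit_ball_vol (real DIM('a))) / a) (far_kernel_bound y))"
      using nn_integral_far_kernel_diff_le_bound[of a y] nn_integral_far_kernel_diff_le_mass[OF a(1), of y] a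
      by (simp add: min_def)
    then have "ennreal \<bar>g y\<bar> * (\<integral>\<^sup>+ x. ennreal (norm (far_kernel a (y - x) - far_kernel a (- x))) \<partial>lborel)
      \<le> ennreal \<bar>g y\<bar> * ennreal (min (2 * (real DIM('a) * unit_ball_vol (real DIM('a))) / a) (far_kernel_bound y))"
      by (intro mult_left_mono) auto
    then show "(\<integral>\<^sup>+ x. ennreal (\<bar>g y\<bar> * norm (far_kernel a (y - x) - far_kernel a (- x))) \<partial>lborel)
      \<le> ennreal (\<bar>g y\<bar> * min (2 * (real DIM('a) * unit_ball_vol (real DIM('a))) / a) (far_kernel_bound y))"
      by (simp add: ennreal_mult' nn_integral_cmult)
  qed
  finally show ?thesis by (auto simp: add_left_mono)
qed

text \<open>By the triangle inequality, the L^1 norms of \<open>riesz_integral a g\<close> and of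
  the kernel multiple differ by at most the L^1 norm of the remainder \<open>D\<close>. The kernel
  multiple has norm exactly V/a times the absolute value of the integral of \<open>g\<close>, and
  multiplication by \<open>a\<close> removes the blow-up.\<close>

lemma riesz_integral_L1_approx:
  fixes g :: "'a::euclidean_space \<Rightarrow> real"
  assumes g: "integrable lborel g"
    and a: "0 < a" "a \<le> a0" "a0 \<le> 1" and fin: "(\<integral>\<^sup>+ x. gagliardo_slice a0 g x \<partial>lborel) < \<infinity>"
  shows "\<bar>a * (\<integral> x. norm (riesz_integral a g x) \<partial>lborel)
      - real DIM('a) * unit_ball_vol (real DIM('a)) * \<bar>\<integral> y. g y \<partial>lborel\<bar>\<bar>
    \<le> a * enn2real (\<integral>\<^sup>+ x. gagliardo_slice a0 g x \<partial>lborel)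
      + (\<integral> y. \<bar>g y\<bar> * min (2 * (real DIM('a) * unit_ball_vol (real DIM('a)))) (a * far_kernel_bound y) \<partial>lborel)"
proof -
  define V where "V = real DIM('a) * unit_ball_vol (real DIM('a))"
  define c where "c = (\<integral> y. g y \<partial>lborel)"
  define S where "S = enn2real (\<integral>\<^sup>+ x. gagliardo_slice a0 g x \<partial>lborel)"
  define D where "D x = riesz_integral a g x - c *\<^sub>R far_kernel a (- x)" for x
  have V: "0 \<le> V" by (simp add: V_def)
  have [measurable]: "g \<in> borel_measurable borel" using g by auto
  have [measurable]: "D \<in> borel_measurable borel" unfolding D_def by measurable
  have S: "(\<integral>\<^sup>+ x. gagliardo_slice a0 g x \<partial>lborel) = ennreal S"
    using fin by (simp add: S_def less_top)
  have S0: "0 \<le> S" by (simp add: S_def)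
  have int_min: "integrable lborel (\<lambda>y. \<bar>g y\<bar> * min (2 * V / a) (far_kernel_bound y))"
  proof (rule Bochner_Integration.integrable_bound)
    show "integrable lborel (\<lambda>y. (2 * V / a) * g y)" using g by simp
    show "AE y in lborel. norm (\<bar>g y\<bar> * min (2 * V / a) (far_kernel_bound y)) \<le> norm (2 * V / a * g y)"
    proof (rule AE_I2)
      fix y :: 'a
      have "\<bar>g y\<bar> * min (2 * V / a) (far_kernel_bound y) \<le> \<bar>g y\<bar> * (2 * V / a)"
        by (intro mult_left_mono) auto
      then show "norm (\<bar>g y\<bar> * min (2 * V / a) (far_kernel_bound y)) \<le> norm (2 * V / a * g y)"
        using V a far_kernel_bound_nonneg[of y] by (simp add: abs_mult mult.commute)
    qed
  qed measurable
  define B where "B = (\<integral> y. \<bar>g y\<bar> * min (2 * V / a) (far_kernel_bound y) \<partial>lborel)"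
  have min0: "0 \<le> \<bar>g y\<bar> * min (2 * V / a) (far_kernel_bound y)" for y
    using V a far_kernel_bound_nonneg[of y] by simp
  have B0: "0 \<le> B" unfolding B_def by (intro integral_nonneg_AE AE_I2 min0)
  have "(\<integral>\<^sup>+ x. ennreal (norm (D x)) \<partial>lborel) \<le> ennreal S
      + (\<integral>\<^sup>+ y. ennreal (\<bar>g y\<bar> * min (2 * V / a) (far_kernel_bound y)) \<partial>lborel)"
    using nn_integral_riesz_integral_approx[OF g a fin] unfolding S D_def V_def c_def .
  also have "\<dots> = ennreal (S + B)"
    unfolding B_def using int_min min0 S0 B0
    by (subst nn_integral_eq_integral) (auto simp: B_def)
  finally have D_le: "(\<integral>\<^sup>+ x. ennreal (norm (D x)) \<partial>lborel) \<le> ennreal (S + B)" .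
  have D_int: "integrable lborel D"
    using D_le by (intro integrableI_bounded) (auto intro: le_less_trans)
  have D_int_le: "(\<integral> x. norm (D x) \<partial>lborel) \<le> S + B"
    using D_le S0 B0 D_int by (subst integral_eq_nn_integral) (auto intro: enn2real_leI)
  have k_int: "integrable lborel (\<lambda>x::'a. c *\<^sub>R far_kernel a (- x))"
    using integrable_far_kernel[OF a(1), of "0::'a"] by simp
  have R_eq: "riesz_integral a g x = D x + c *\<^sub>R far_kernel a (- x)" for x
    by (simp add: D_def)
  have R_int: "integrable lborel (\<lambda>x. riesz_integral a g x)"
    unfolding R_eq using D_int k_int by simp
  have k_val: "(\<integral> x. norm (c *\<^sub>R far_kernel a (- x :: 'a)) \<partial>lborel) = \<bar>c\<bar> * V / a"
    using integral_norm_far_kernel[OF a(1), of "0::'a"] by (simp add: V_def)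
  have "\<bar>(\<integral> x. norm (riesz_integral a g x) \<partial>lborel) - \<bar>c\<bar> * V / a\<bar>
    = \<bar>\<integral> x. norm (riesz_integral a g x) - norm (c *\<^sub>R far_kernel a (- x)) \<partial>lborel\<bar>"
    using R_int k_int by (subst Bochner_Integration.integral_diff) (auto simp only: k_val integrable_norm)
  also have "\<dots> \<le> (\<integral> x. \<bar>norm (riesz_integral a g x) - norm (c *\<^sub>R far_kernel a (- x))\<bar> \<partial>lborel)"
    by (rule integral_abs_bound)
  also have "\<dots> \<le> (\<integral> x. norm (D x) \<partial>lborel)"
    using R_int k_int D_int
    by (intro integral_mono) (auto simp only: D_def norm_triangle_ineq3 intro!: integrable_norm integrable_abs Bochner_Integration.integrable_diff)
  also note D_int_le
  finally have main: "\<bar>(\<integral> x. norm (riesz_integral a g x) \<partial>lborel) - \<bar>c\<bar> * V / a\<bar> \<le> S + B" .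
  \<comment> \<open>Moving \<open>a\<close> inside the minimum turns the cap 2V/a into 2V, which is
    independent of \<open>a\<close>.\<close>
  have aB: "a * B = (\<integral> y. \<bar>g y\<bar> * min (2 * V) (a * far_kernel_bound y) \<partial>lborel)"
  proof -
    have eq: "a * (\<bar>g y\<bar> * min (2 * V / a) (far_kernel_bound y)) = \<bar>g y\<bar> * min (2 * V) (a * far_kernel_bound y)" for y
      using a by (simp add: min_mult_distrib_left mult.left_commute)
    then show ?thesis
      unfolding B_def by (subst integral_mult_right_zero[symmetric]) (simp only: eq)
  qed
  have "\<bar>a * (\<integral> x. norm (riesz_integral a g x) \<partial>lborel) - V * \<bar>c\<bar>\<bar>
    = a * \<bar>(\<integral> x. norm (riesz_integral a g x) \<partial>lborel) - \<bar>c\<bar> * V / a\<bar>"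
  proof -
    have "a * (\<integral> x. norm (riesz_integral a g x) \<partial>lborel) - V * \<bar>c\<bar>
      = a * ((\<integral> x. norm (riesz_integral a g x) \<partial>lborel) - \<bar>c\<bar> * V / a)"
      using a by (simp add: field_simps)
    then show ?thesis using a by (simp only: abs_mult abs_of_pos)
  qed
  also have "\<dots> \<le> a * (S + B)" using main a by (intro mult_left_mono) auto
  also have "\<dots> = a * S + a * B" by (simp add: algebra_simps)
  finally show ?thesis unfolding aB V_def S_def c_def .
qed

text \<open>The first error term is \<open>a\<close> times a finite number. In the second the
  integrand tends to 0 pointwise and is dominated by 2V|g|.\<close>

lemma riesz_integral_limit:
  fixes g :: "'a::euclidean_space \<Rightarrow> real"
  assumes g: "integrable lborel g"
    and a0: "0 < a0" "a0 \<le> 1" and fin: "(\<integral>\<^sup>+ x. gagliardo_slice a0 g x \<partial>lborel) < \<infinity>"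
  shows "((\<lambda>a. a * (\<integral> x. norm (riesz_integral a g x) \<partial>lborel)) \<longlongrightarrow>
      real DIM('a) * unit_ball_vol (real DIM('a)) * \<bar>\<integral> y. g y \<partial>lborel\<bar>) (at_right 0)"
proof -
  define V where "V = real DIM('a) * unit_ball_vol (real DIM('a))"
  have V: "0 \<le> V" by (simp add: V_def)
  have [measurable]: "g \<in> borel_measurable borel" using g by auto
  \<comment> \<open>Dominated convergence is applied along an arbitrary sequence of positive numbers
    tending to 0.\<close>
  have lim: "((\<lambda>a. \<integral> y. \<bar>g y\<bar> * min (2 * V) (a * far_kernel_bound y) \<partial>lborel) \<longlongrightarrow> 0) (at_right 0)"
    unfolding tendsto_at_iff_sequentially comp_def
  proof (intro allI impI)
    fix X :: "nat \<Rightarrow> real"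
    assume X: "\<forall>i. X i \<in> {0<..} - {0}" and X0: "X \<longlonglongrightarrow> 0"
    have "(\<lambda>i. \<integral> y. \<bar>g y\<bar> * min (2 * V) (X i * far_kernel_bound y) \<partial>lborel) \<longlonglongrightarrow> (\<integral> (y::'a). 0 \<partial>lborel)"
    proof (rule integral_dominated_convergence)
      show "integrable lborel (\<lambda>y. \<bar>g y\<bar> * (2 * V))" using g by simp
      show "AE y in lborel. (\<lambda>i. \<bar>g y\<bar> * min (2 * V) (X i * far_kernel_bound y)) \<longlonglongrightarrow> 0"
      proof (rule AE_I2)
        fix y :: 'a
        have "(\<lambda>i. \<bar>g y\<bar> * min (2 * V) (X i * far_kernel_bound y)) \<longlonglongrightarrow> \<bar>g y\<bar> * min (2 * V) (0 * far_kernel_bound y)"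
          by (intro tendsto_intros X0)
        then show "(\<lambda>i. \<bar>g y\<bar> * min (2 * V) (X i * far_kernel_bound y)) \<longlonglongrightarrow> 0"
          using V by simp
      qed
      show "AE y in lborel. norm (\<bar>g y\<bar> * min (2 * V) (X i * far_kernel_bound y)) \<le> \<bar>g y\<bar> * (2 * V)" for i
      proof (rule AE_I2)
        fix y :: 'a
        have "0 \<le> X i * far_kernel_bound y"
          using X far_kernel_bound_nonneg[of y] by (simp add: less_imp_le)
        then show "norm (\<bar>g y\<bar> * min (2 * V) (X i * far_kernel_bound y)) \<le> \<bar>g y\<bar> * (2 * V)"
          using V by (auto simp: abs_mult intro!: mult_left_mono)
      qed
    qed measurable
    then show "(\<lambda>i. \<integral> y. \<bar>g y\<bar> * min (2 * V) (X i * far_kernel_bound y) \<partial>lborel) \<longlonglongrightarrow> 0" by simp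
  qed
  have "((\<lambda>a. a * (\<integral> x. norm (riesz_integral a g x) \<partial>lborel) - V * \<bar>\<integral> y. g y \<partial>lborel\<bar>) \<longlongrightarrow> 0) (at_right 0)"
  proof (rule Lim_null_comparison)
    show "\<forall>\<^sub>F a in at_right 0. norm (a * (\<integral> x. norm (riesz_integral a g x) \<partial>lborel) - V * \<bar>\<integral> y. g y \<partial>lborel\<bar>)
      \<le> a * enn2real (\<integral>\<^sup>+ x. gagliardo_slice a0 g x \<partial>lborel)
        + (\<integral> y. \<bar>g y\<bar> * min (2 * V) (a * far_kernel_bound y) \<partial>lborel)"
      \<comment> \<open>The error estimate is available for 0 < a < a0.\<close>
      using eventually_at_right_real[OF a0(1)]
      by eventually_elim (use riesz_integral_L1_approx[OF g _ _ a0(2) fin] in \<open>auto simp: V_def\<close>)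
    show "((\<lambda>a. a * enn2real (\<integral>\<^sup>+ x. gagliardo_slice a0 g x \<partial>lborel)
        + (\<integral> y. \<bar>g y\<bar> * min (2 * V) (a * far_kernel_bound y) \<partial>lborel)) \<longlongrightarrow> 0) (at_right 0)"
      by (rule tendsto_eq_intros tendsto_ident_at lim refl | simp)+
  qed
  then show ?thesis by (simp add: V_def LIM_zero_iff)
qed

section \<open>Return to the fractional gradient, its constant and the completed measure\<close>

lemma frac_const_continuous_at_0: "(frac_const n \<longlongrightarrow> frac_const n 0) (at_right 0)"
proof -
  \<comment> \<open>At 0 the Gamma arguments are (n+1)/2 and 1/2. Both are positive, hence away from
    the poles, and the denominator does not vanish.\<close>
  have "(frac_const n \<longlongrightarrow> frac_const n 0) (at 0)"
    unfolding frac_const_def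
    by (intro tendsto_intros) (auto dest: nonpos_Ints_nonpos simp: Gamma_eq_zero_iff)
  then show ?thesis by (rule tendsto_within_subset) simp
qed

lemma frac_const_nonneg: "0 \<le> a \<Longrightarrow> a < 1 \<Longrightarrow> 0 \<le> frac_const n a"
  unfolding frac_const_def by (intro mult_nonneg_nonneg divide_nonneg_nonneg) auto

lemma unit_ball_volume_eq: "unit_ball_volume TYPE('n::finite) = unit_ball_vol (real CARD('n))"
  unfolding unit_ball_volume_def
  using content_ball[of 1 "0 :: real ^ 'n"] by simp

text \<open>The exceptional null set is discarded first in the outer variable and then, at each
  remaining point, in the inner one.\<close>

lemma frac_seminorm_eq_lborel:
  fixes f g :: "real ^ 'n::finite \<Rightarrow> real"
  assumes fg: "AE x in lborel. f x = g x"
  shows "frac_seminorm a f = (\<integral>\<^sup>+ x. gagliardo_slice a g x \<partial>lborel)"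
  unfolding frac_seminorm_def gagliardo_slice_def nn_integral_completion
proof (rule nn_integral_cong_AE, use fg in eventually_elim)
  fix y
  assume y: "f y = g y"
  show "(\<integral>\<^sup>+ x. ennreal (\<bar>f x - f y\<bar> / norm (x - y) powr (real CARD('n) + a)) \<partial>lborel)
    = (\<integral>\<^sup>+ x. ennreal (\<bar>g x - g y\<bar> / norm (x - y) powr (real DIM(real ^ 'n) + a)) \<partial>lborel)"
    by (rule nn_integral_cong_AE, use fg in eventually_elim) (simp add: y)
qed

text \<open>Agreement at the point \<open>x\<close> itself is assumed because f(x) enters the
  integrand for every \<open>y\<close>; elsewhere agreement almost everywhere suffices.\<close>

lemma frac_gradient_eq_lborel:
  fixes f g :: "real ^ 'n::finite \<Rightarrow> real"
  assumes f: "f \<in> borel_measurable lebesgue" and g: "g \<in> borel_measurable borel"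
    and fg: "AE x in lborel. f x = g x" and x: "f x = g x"
  shows "frac_gradient a f x = frac_const CARD('n) a *\<^sub>R riesz_integral a g x"
proof -
  note [measurable] = f g
  have [measurable]: "g \<in> borel_measurable lebesgue"
    using g by (simp add: measurable_completion)
  have k: "(\<lambda>y. ((g y - g x) / norm (y - x) powr (real CARD('n) + a + 1)) *\<^sub>R (y - x)) \<in> borel_measurable borel"
    by measurable
  have k': "(\<lambda>y. (1 / norm (y - x) powr (real CARD('n) + a + 1)) *\<^sub>R (y - x)) \<in> borel_measurable lebesgue"
    by (rule measurable_completion) measurable
  have "(\<lambda>y. (f y - f x) *\<^sub>R ((1 / norm (y - x) powr (real CARD('n) + a + 1)) *\<^sub>R (y - x))) \<in> borel_measurable lebesgue"
    by (intro borel_measurable_scaleR k') measurable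
  then have m: "(\<lambda>y. ((f y - f x) / norm (y - x) powr (real CARD('n) + a + 1)) *\<^sub>R (y - x)) \<in> borel_measurable lebesgue"
    by simp
  have "(\<integral> y. ((f y - f x) / norm (y - x) powr (real CARD('n) + a + 1)) *\<^sub>R (y - x) \<partial>lebesgue)
    = (\<integral> y. ((g y - g x) / norm (y - x) powr (real CARD('n) + a + 1)) *\<^sub>R (y - x) \<partial>lebesgue)"
  proof (rule integral_cong_AE[OF m])
    show "AE y in lebesgue. ((f y - f x) / norm (y - x) powr (real CARD('n) + a + 1)) *\<^sub>R (y - x)
      = ((g y - g x) / norm (y - x) powr (real CARD('n) + a + 1)) *\<^sub>R (y - x)"
      using AE_completion[OF fg] by eventually_elim (simp add: x)
  qed (use k in \<open>simp add: measurable_completion\<close>)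
  also have "\<dots> = riesz_integral a g x"
    unfolding riesz_integral_def using k by (simp add: integral_completion)
  finally show ?thesis by (simp add: frac_gradient_def)
qed

text \<open>The points with f(x) different from g(x) form a null set, invisible to the outer
  integral. For 0 <= a < 1 the constant is nonnegative, so it leaves the norm unchanged.\<close>

lemma integral_norm_frac_gradient_eq:
  fixes f g :: "real ^ 'n::finite \<Rightarrow> real"
  assumes f: "f \<in> borel_measurable lebesgue" and g: "g \<in> borel_measurable borel"
    and fg: "AE x in lborel. f x = g x" and a: "0 \<le> a" "a < 1"
  shows "(\<integral> x. norm (frac_gradient a f x) \<partial>lebesgue)
    = frac_const CARD('n) a * (\<integral> x. norm (riesz_integral a g x) \<partial>lborel)"
proof -
  note [measurable] = g
  have *: "AE x in lebesgue. norm (frac_gradient a f x) = frac_const CARD('n) a * norm (riesz_integral a g x)"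
    using AE_completion[OF fg]
    by eventually_elim (use frac_const_nonneg[OF a] in \<open>simp add: frac_gradient_eq_lborel[OF f g fg]\<close>)
  have r: "(\<lambda>x. frac_const CARD('n) a * norm (riesz_integral a g x)) \<in> borel_measurable lborel"
    by measurable
  have r': "(\<lambda>x. frac_const CARD('n) a * norm (riesz_integral a g x)) \<in> borel_measurable lebesgue"
    by (rule measurable_completion) (use r in simp)
  have "(\<integral> x. norm (frac_gradient a f x) \<partial>lebesgue) = (\<integral> x. frac_const CARD('n) a * norm (riesz_integral a g x) \<partial>lebesgue)"
  proof (rule integral_cong_AE)
    \<comment> \<open>Measurability is inherited from a function equal almost everywhere, as
      Lebesgue measure is complete.\<close>
    show "(\<lambda>x. norm (frac_gradient a f x)) \<in> borel_measurable lebesgue"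
      by (rule borel_measurable_AE[OF r']) (use * in \<open>simp add: eq_commute\<close>)
  qed (use * r' in auto)
  also have "\<dots> = (\<integral> x. frac_const CARD('n) a * norm (riesz_integral a g x) \<partial>lborel)"
    using r by (simp add: integral_completion)
  finally show ?thesis by simp
qed

theorem theorem5p6:
  fixes f :: "real ^ 'n::finite \<Rightarrow> real"
  assumes "f \<in> (\<Union>\<alpha>\<in>{0<..<1}. frac_sobolev \<alpha>)"
  shows "((\<lambda>\<alpha>. \<alpha> * (\<integral> x. norm (frac_gradient \<alpha> f x) \<partial>lebesgue)) \<longlongrightarrow>
           real CARD('n) * unit_ball_volume TYPE('n) * frac_const CARD('n) 0 * \<bar>\<integral> x. f x \<partial>lebesgue\<bar>)
         (at_right 0)"
proof -
  obtain a0 where a0: "0 < a0" "a0 < 1" and f: "integrable lebesgue f" and S: "frac_seminorm a0 f < \<infinity>"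
    using assms by (auto simp: frac_sobolev_def)
  have fm: "f \<in> borel_measurable lebesgue" using f by auto
  \<comment> \<open>A Borel representative makes the product measurability and Fubini arguments over
    \<open>lborel\<close> applicable.\<close>
  obtain g where g: "g \<in> borel_measurable borel" and fg: "AE x in lborel. f x = g x"
    using completion_ex_borel_measurable_real[OF fm] by auto
  have gm: "g \<in> borel_measurable lebesgue"
    using g by (simp add: measurable_completion)
  have "integrable lebesgue g"
    using integrable_cong_AE[OF fm gm AE_completion[OF fg]] f by blast
  then have gi: "integrable lborel g"
    using g by (simp add: integrable_completion)
  have gf: "(\<integral> x. f x \<partial>lebesgue) = (\<integral> x. g x \<partial>lborel)"
    using integral_cong_AE[OF fm gm AE_completion[OF fg]] g by (simp add: integral_completion)
  have "((\<lambda>a. a * (\<integral> x. norm (riesz_integral a g x) \<partial>lborel)) \<longlongrightarrow>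
      real CARD('n) * unit_ball_vol (real CARD('n)) * \<bar>\<integral> y. g y \<partial>lborel\<bar>) (at_right 0)"
    using riesz_integral_limit[OF gi a0(1)] a0(2) S unfolding frac_seminorm_eq_lborel[OF fg] by simp
  then have "((\<lambda>a. frac_const CARD('n) a * (a * (\<integral> x. norm (riesz_integral a g x) \<partial>lborel))) \<longlongrightarrow>
      frac_const CARD('n) 0 * (real CARD('n) * unit_ball_vol (real CARD('n)) * \<bar>\<integral> y. g y \<partial>lborel\<bar>)) (at_right 0)"
    by (rule tendsto_mult[OF frac_const_continuous_at_0])
  then have "((\<lambda>a. frac_const CARD('n) a * (a * (\<integral> x. norm (riesz_integral a g x) \<partial>lborel))) \<longlongrightarrow>
      real CARD('n) * unit_ball_volume TYPE('n) * frac_const CARD('n) 0 * \<bar>\<integral> x. f x \<partial>lebesgue\<bar>) (at_right 0)"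
    by (simp add: gf unit_ball_volume_eq mult_ac)
  \<comment> \<open>The identity is required only for small positive \<open>a\<close>; it holds on
    (0,1), where the constant is nonnegative.\<close>
  moreover have "\<forall>\<^sub>F a in at_right 0. frac_const CARD('n) a * (a * (\<integral> x. norm (riesz_integral a g x) \<partial>lborel))
    = a * (\<integral> x. norm (frac_gradient a f x) \<partial>lebesgue)"
    using eventually_at_right_real[of 0 "1::real", OF zero_less_one]
    by eventually_elim (simp add: integral_norm_frac_gradient_eq[OF fm g fg])
  ultimately show ?thesis by (rule Lim_transform_eventually)
qed

end
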